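(* Let $\Delta\subset\mathbb C$ be the open unit disc, $\Delta^*=\Delta\setminus\{0\}$, let $h:\Delta^*\to\mathbb C^*$ be holomorphic, and set $T(s)=\log(1/|s|)$. Assume that the cluster set in $\mathbb R$ of $\log|h(s)|/T(s)$ as $s\to0$ is finite and nonempty. Then $h$ is meromorphic at $0$.
   Context: For $w(s)=\log|h(s)|/T(s)$, the cluster set in $\mathbb R$ of $w$ as $s\to0$ is $\{a\in\mathbb R:\text{ there exists a sequence } s_m\in\Delta^*\text{ with } s_m\to0\text{ and } w(s_m)\to a\}$ (only finite real values $a$ are counted). "Meromorphic at $0$" means that the isolated singularity at $0$ is removable or a pole. *)

theory Defs
  imports "HOL-Complex_Analysis.Complex_Analysis"
begin

abbreviation punctured_disc :: "complex set"
  where "punctured_disc \<equiv> ball 0 1 - {0}"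

(* The limits a range over type real, so sequences along which w tends to
   plus or minus infinity contribute nothing to the cluster set. *)
definition real_cluster_set :: "complex set \<Rightarrow> (complex \<Rightarrow> real) \<Rightarrow> complex \<Rightarrow> real set"
  where "real_cluster_set D w z =
    {a. \<exists>s :: nat \<Rightarrow> complex. (\<forall>m. s m \<in> D) \<and> s \<longlonglongrightarrow> z \<and> (\<lambda>m. w (s m)) \<longlonglongrightarrow> a}"

definition T :: "complex \<Rightarrow> real"
  where "T s = ln (1 / norm s)"

end

theory Submission
  imports Defs
begin

text \<open>
  Every punctured ball around \<open>0\<close> is connected, so a continuous real function taking values on both
  sides of \<open>c\<close> arbitrarily close to \<open>0\<close> attains \<open>c\<close> arbitrarily close to \<open>0\<close>, and \<open>c\<close> is a cluster
  value. Choosing \<open>c\<close> to be a natural number \<open>m\<close> above the finite cluster set, which has a point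
  below \<open>m\<close>, gives \<open>ln \<bar>h\<bar> < m T\<close> near \<open>0\<close>. Hence \<open>s\<^sup>m h(s)\<close> is bounded there, and its singularity is removable.
\<close>

lemma frequently_eq_imp_real_cluster_set:
  assumes "\<exists>\<^sub>F s in at z. s \<in> D \<and> w s = c"
  shows "c \<in> real_cluster_set D w z"
proof -
  \<comment> \<open>Picking one point within each radius \<open>inverse (real (Suc n))\<close>
    yields a sequence tending to \<open>z\<close> on which \<open>w\<close> is constantly
    \<open>c\<close>.\<close>
  have "\<exists>s. s \<in> D \<and> w s = c \<and> dist s z < inverse (real (Suc n))" for n
    using assms[unfolded frequently_at, rule_format, of "inverse (real (Suc n))"] by auto
  then obtain s where s: "\<And>n. s n \<in> D" "\<And>n. w (s n) = c"
    "\<And>n. dist (s n) z < inverse (real (Suc n))"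
    by metis
  have "norm (dist (s n) z) \<le> inverse (real (Suc n))" for n
    using less_imp_le[OF s(3)] by simp
  then have "(\<lambda>n. dist (s n) z) \<longlonglongrightarrow> 0"
    by (intro Lim_null_comparison[OF always_eventually LIMSEQ_inverse_real_of_nat] allI)
  then have "s \<longlonglongrightarrow> z"
    by (rule tendsto_dist_iff[THEN iffD2])
  then show ?thesis
    using s(1,2) unfolding real_cluster_set_def by (auto intro!: exI[of _ s])
qed

lemma real_cluster_set_imp_frequently_less:
  assumes "a \<in> real_cluster_set D w z" "z \<notin> D" "a < c"
  shows "\<exists>\<^sub>F s in at z. s \<in> D \<and> w s < c"
proof -
  obtain s where s: "\<And>n. s n \<in> D" "s \<longlonglongrightarrow> z" "(\<lambda>n. w (s n)) \<longlonglongrightarrow> a"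
    using assms(1) unfolding real_cluster_set_def by auto
  \<comment> \<open>The filter \<open>at z\<close> leaves out \<open>z\<close> itself; the sequence
    avoids \<open>z\<close> because it lies in \<open>D\<close>.\<close>
  have "filterlim s (at z) sequentially"
    using s(1,2) assms(2) by (auto simp: filterlim_at intro!: always_eventually)
  moreover have "\<forall>\<^sub>F n in sequentially. w (s n) < c"
    using s(3) assms(3) by (rule order_tendstoD)
  then have "\<exists>\<^sub>F n in sequentially. s n \<in> D \<and> w (s n) < c"
    using s(1) by (simp add: eventually_frequently)
  \<comment> \<open>A property failing eventually at \<open>z\<close> would also fail eventually
    along \<open>s\<close>.\<close>
  ultimately show ?thesis
    by (auto simp: frequently_def filterlim_iff)
qed

lemma eventually_less_of_notin_real_cluster_set:
  assumes w: "continuous_on (ball z r - {z}) w" and r: "0 < r"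
    and a: "a \<in> real_cluster_set (ball z r - {z}) w z" "a < c"
    and c: "c \<notin> real_cluster_set (ball z r - {z}) w z"
  shows "\<forall>\<^sub>F s in at z. w s < c"
proof (rule ccontr)
  let ?D = "ball z r - {z}"
  assume "\<not> ?thesis"
  then have ge: "\<exists>\<^sub>F s in at z. c \<le> w s"
    by (simp add: frequently_def not_le)
  have lt: "\<exists>\<^sub>F s in at z. s \<in> ?D \<and> w s < c"
    using a by (intro real_cluster_set_imp_frequently_less) auto
  have "\<exists>s. s \<noteq> z \<and> dist s z < d \<and> s \<in> ?D \<and> w s = c" if "d > 0" for d
  proof -
    \<comment> \<open>The bound \<open>r\<close> keeps \<open>?B\<close> where \<open>w\<close> is
      continuous, the bound \<open>d\<close> keeps it near \<open>z\<close>.\<close>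
    let ?B = "ball z (min d r) - {z}"
    obtain x where x: "x \<in> ?B" "c \<le> w x"
      using ge[unfolded frequently_at, rule_format, of "min d r"] \<open>d > 0\<close> r
      by (auto simp: dist_commute)
    obtain y where y: "y \<in> ?B" "w y < c"
      using lt[unfolded frequently_at, rule_format, of "min d r"] \<open>d > 0\<close> r
      by (auto simp: dist_commute)
    \<comment> \<open>The plane has real dimension 2, so removing the centre does not disconnect the
      ball.\<close>
    have "connected ?B"
      by (intro connected_punctured_ball) simp
    moreover have "continuous_on ?B w"
      by (rule continuous_on_subset[OF w]) auto
    ultimately have "connected (w ` ?B)"
      by (rule connected_continuous_image[rotated])
    then have "c \<in> w ` ?B"
      by (rule connectedD_interval[of _ "w y" "w x"]) (use x y in auto)
    then show ?thesis
      by (auto simp: dist_commute)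
  qed
  then have "c \<in> real_cluster_set ?D w z"
    by (intro frequently_eq_imp_real_cluster_set) (auto simp: frequently_at)
  with c show False ..
qed

text \<open>One factor \<open>s - z\<close> beyond the bounded product forces the limit 0, so
  \<open>k\<close> has a non-essential singularity at \<open>z\<close>. Dividing the power out again
  gives \<open>h\<close> off \<open>z\<close>, and meromorphy at \<open>z\<close> does not depend on
  the value there.\<close>

lemma meromorphic_at_of_power_bound:
  assumes h: "h holomorphic_on ball z r - {z}" and r: "0 < r"
    and b: "\<forall>\<^sub>F s in at z. norm ((s - z) ^ m * h s) \<le> B"
  shows "h meromorphic_on {z}"
proof -
  define k where "k s = (s - z) ^ Suc m * h s" for s
  have iso: "isolated_singularity_at k z"
    unfolding isolated_singularity_at_def k_def
    by (intro exI[of _ r] conjI r analytic_on_open[THEN iffD2] open_Diff holomorphic_intros h) auto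
  have "k \<midarrow>z\<rightarrow> 0"
  proof (rule Lim_null_comparison)
    show "\<forall>\<^sub>F s in at z. norm (k s) \<le> norm (s - z) * B"
      using b by eventually_elim (auto simp: k_def norm_mult mult.assoc intro: mult_left_mono)
    show "((\<lambda>s. norm (s - z) * B) \<longlongrightarrow> 0) (at z)"
      by (auto intro!: tendsto_eq_intros)
  qed
  then have "k meromorphic_on {z}"
    using iso not_essential_def by (auto simp: meromorphic_at_iff)
  then have "(\<lambda>s. k s / (s - z) ^ Suc m) meromorphic_on {z}"
    by (intro meromorphic_intros)
  moreover have "\<forall>\<^sub>F s in at z. k s / (s - z) ^ Suc m = h s"
    by (auto simp: eventually_at_filter k_def)
  ultimately show ?thesis
    using meromorphic_on_cong[of "{z}" "\<lambda>s. k s / (s - z) ^ Suc m" h "{z}"] by simp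
qed

theorem lemma2p1:
  fixes h :: "complex \<Rightarrow> complex"
  assumes "h holomorphic_on punctured_disc"
    and "\<And>s. s \<in> punctured_disc \<Longrightarrow> h s \<noteq> 0"
    and "finite (real_cluster_set punctured_disc (\<lambda>s. ln (norm (h s)) / T s) 0)"
    and "real_cluster_set punctured_disc (\<lambda>s. ln (norm (h s)) / T s) 0 \<noteq> {}"
  shows "h meromorphic_on {0}"
proof -
  define w where "w s = ln (norm (h s)) / T s" for s
  let ?F = "real_cluster_set punctured_disc w 0"
  have F: "finite ?F" "?F \<noteq> {}"
    using assms(3,4) unfolding w_def by auto
  have T_pos: "T s > 0" if "s \<in> punctured_disc" for s
    using that by (auto simp: T_def)
  have "continuous_on punctured_disc w"
    unfolding w_def
  proof (intro continuous_on_divide continuous_on_ln continuous_on_norm)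
    show "continuous_on punctured_disc h"
      using assms(1) by (rule holomorphic_on_imp_continuous_on)
    show "continuous_on punctured_disc T"
      unfolding T_def by (intro continuous_intros) auto
  qed (use assms(2) T_pos in force)+
  moreover obtain m :: nat where m: "Max ?F < real m"
    using reals_Archimedean2 by blast
  then have less_m: "\<And>a. a \<in> ?F \<Longrightarrow> a < real m"
    using F by auto
  moreover obtain a where "a \<in> ?F"
    using F(2) by blast
  \<comment> \<open>Were \<open>real m\<close> itself a cluster value, \<open>less_m\<close> would
    give \<open>real m < real m\<close>.\<close>
  ultimately have "\<forall>\<^sub>F s in at 0. w s < real m"
    using less_m[of "real m"]
    by (intro eventually_less_of_notin_real_cluster_set[of 0 1 w a]) auto
  moreover have "\<forall>\<^sub>F s in at 0. s \<in> punctured_disc"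
    by (intro eventually_at_in_open) auto
  ultimately have "\<forall>\<^sub>F s in at 0. norm ((s - 0) ^ m * h s) \<le> 1"
  proof eventually_elim
    case (elim s)
    then have pos: "norm s > 0" "norm (h s) > 0"
      using assms(2) by auto
    have "ln (norm (h s)) < m * T s"
      using elim T_pos[of s] by (simp add: w_def pos_divide_less_eq)
    \<comment> \<open>Since \<open>T s = - ln (norm s)\<close>, the term \<open>m * T s\<close>
      moves to the left as the logarithm of \<open>norm s ^ m\<close>.\<close>
    then have "ln (norm s ^ m * norm (h s)) < 0"
      using pos by (simp add: T_def ln_mult ln_div ln_realpow)
    then show ?case
      using pos by (simp add: norm_mult norm_power)
  qed
  then show ?thesis
    using assms(1) by (intro meromorphic_at_of_power_bound[of h 0 1]) auto
qed

end
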